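(* For every $\Delta\ge d\ge3$ and every $g\ge3$ there exist $\delta>0$ and $c>0$ such that every $n$-vertex graph $G$ with minimum degree at least $d$, maximum degree at most $\Delta$, and universal girth at most $g$ has at least $\lceil cn\rceil$ eigenvalues (of its adjacency matrix, counted with multiplicity) that are larger than $2\sqrt{d-1}+\delta$.
   Context: A closed walk $v_1v_2\dots v_kv_1$ in a graph is retracting-free if $v_{i-1}\ne v_{i+1}$ for all $i=1,\dots,k$, where $v_0=v_k$ and $v_{k+1}=v_1$. The universal girth $m(G)$ of a finite graph $G$ is the smallest integer $k$ such that every vertex of $G$ lies on (is the start of) a retracting-free closed walk of length $k$. *)

theory Defs
  imports
    "HOL-Analysis.Analysis"
    "HOL-Library.Extended_Nat"
    "Jordan_Normal_Form.Char_Poly"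
    "Graph_Theory.Graph_Theory"
begin

text \<open>
  A finite simple graph is a \<^locale>\<open>pair_graph\<close>: a finite, symmetric, loop-free digraph without
  parallel arcs. By symmetry the degree of a vertex is its out-degree.
\<close>

definition min_degree :: "'a pair_pre_digraph \<Rightarrow> nat" where
  "min_degree G = Min ((\<lambda>v. out_degree (with_proj G) v) ` pverts G)"

definition max_degree :: "'a pair_pre_digraph \<Rightarrow> nat" where
  "max_degree G = Max ((\<lambda>v. out_degree (with_proj G) v) ` pverts G)"

text \<open>
  A closed walk $v_1 v_2 \dots v_k v_1$ of length $k \geq 1$ is represented by the list
  $[v_1, \dots, v_k]$, without the final repetition of the start vertex.
\<close>

definition closed_vwalk :: "'a pair_pre_digraph \<Rightarrow> 'a list \<Rightarrow> bool" where
  "closed_vwalk G p \<longleftrightarrow> p \<noteq> [] \<and> vwalk (p @ [hd p]) (with_proj G)"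

text \<open>
  The indices are cyclic, so the condition also covers the two turns at the closing point,
  $v_{k-1} \neq v_1$ and $v_k \neq v_2$.
\<close>

definition retracting_free :: "'a list \<Rightarrow> bool" where
  "retracting_free p \<longleftrightarrow> (\<forall>i < length p. p ! i \<noteq> p ! ((i + 2) mod length p))"

text \<open>The infimum is \<open>\<infinity>\<close> if there is no suitable \<open>k\<close>.\<close>

definition universal_girth :: "'a pair_pre_digraph \<Rightarrow> enat" where
  "universal_girth G = Inf {enat k | k. 0 < k \<and> (\<forall>v \<in> pverts G.
     \<exists>p. closed_vwalk G p \<and> retracting_free p \<and> length p = k \<and> hd p = v)}"

text \<open>The adjacency matrix of a graph with vertex set \<open>{0..<n}\<close>.\<close>

definition adjacency_mat :: "nat \<Rightarrow> nat pair_pre_digraph \<Rightarrow> real mat" where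
  "adjacency_mat n G = mat n n (\<lambda>(i, j). if (i, j) \<in> parcs G then 1 else 0)"

text \<open>
  The multiset of real eigenvalues with their algebraic multiplicities. Adjacency matrices of
  graphs are symmetric, so this is their full spectrum and algebraic and geometric multiplicities
  agree.
\<close>

definition eigenvalue_mset :: "real mat \<Rightarrow> real multiset" where
  "eigenvalue_mset A = proots (char_poly A)"

end

theory Submission
  imports Defs "Jordan_Normal_Form.Schur_Decomposition" "Jordan_Normal_Form.Jordan_Normal_Form_Uniqueness"
begin

text \<open>
  Put \<open>q = d - 1\<close>. Suppose that \<open>h > 0\<close> satisfies \<open>A h \<le> (2 + \<epsilon>) \<surd>q h\<close> on a large ball, and let
  \<open>u(x, y) = \<surd>q h y / h x\<close> for an edge \<open>xy\<close>. Every edge \<open>px\<close> is continued by some edge \<open>xy\<close>,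
  \<open>y \<noteq> p\<close>, with \<open>u(x, y) \<le> 2 + \<epsilon> - 1 / u(p, x)\<close>. Iterating, a ratio below \<open>1\<close> would eventually
  become negative, and a ratio above \<open>1\<close> can be brought close to \<open>1\<close>. As all ratios are
  essentially at least \<open>1\<close>, a ratio close to \<open>1\<close> forces all forward ratios within distance \<open>g\<close> to be
  close to \<open>1\<close>, hence below \<open>\<surd>q\<close>, so \<open>h\<close> strictly decreases along every forward non-backtracking
  walk of length at most \<open>g\<close>. This is absurd for the retracting-free closed walk
  at the end point, one of whose two orientations does not start by backtracking.

  Applied to a truncated Green's function of \<open>A + \<Delta>\<close>, this shows that some power of \<open>A + \<Delta>\<close> has
  all its diagonal entries at least the same power of a number exceeding \<open>\<Delta> + 2 \<surd>q\<close>. Comparing the trace of that power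
  with the power sum of the eigenvalues, which lie in \<open>[-\<Delta>, \<Delta>]\<close>, bounds the number of large eigenvalues from below.
\<close>

section \<open>Positive superharmonic functions near non-backtracking closed walks\<close>

text \<open>\<open>h\<close> is unconstrained here: positivity and the superharmonic inequality are
  imposed only locally, through \<open>safe\<close>, since the truncated Green's function is
  controlled only on a ball.\<close>

locale superharmonic =
  fixes V :: "'a set" and N :: "'a \<Rightarrow> 'a set" and q :: nat and h :: "'a \<Rightarrow> real" and \<eta> :: real
  assumes finite_N: "\<And>x. finite (N x)"
    and sym_N: "\<And>x y. y \<in> N x \<Longrightarrow> x \<in> N y"
    and card_N: "\<And>x. x \<in> V \<Longrightarrow> q + 1 \<le> card (N x)"
    and q_ge_2: "2 \<le> q"
    and \<eta>_pos: "0 < \<eta>" and \<eta>_less_1: "\<eta> < 1"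
begin

text \<open>This size makes u \<mapsto> 2 + \<epsilon> - 1 / u lower u by at least \<epsilon>
  whenever u is further than \<eta> from 1.\<close>

definition \<epsilon> :: real where "\<epsilon> = \<eta>\<^sup>2 / 4"

text \<open>A countdown along walks: each step of a walk costs one unit of radius.\<close>

primrec safe :: "nat \<Rightarrow> 'a \<Rightarrow> bool" where
  "safe 0 x \<longleftrightarrow> x \<in> V \<and> h x > 0"
| "safe (Suc r) x \<longleftrightarrow> x \<in> V \<and> h x > 0 \<and> (\<Sum>y\<in>N x. h y) \<le> sqrt q * (2 + \<epsilon>) * h x \<and>
     (\<forall>y\<in>N x. safe r y)"

text \<open>Normalised so that the stationary value of the recursion \<open>u \<mapsto> 2 - 1 / u\<close> for ratios along
  a non-backtracking walk is \<open>1\<close>.\<close>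

definition ratio :: "'a \<Rightarrow> 'a \<Rightarrow> real" where
  "ratio x y = sqrt q * h y / h x"

lemma safe_pos: "safe r x \<Longrightarrow> h x > 0"
  by (cases r) auto

lemma safe_Suc_imp: "safe (Suc r) x \<Longrightarrow> safe r x"
  by (induction r arbitrary: x) auto

lemma safe_mono: "safe r x \<Longrightarrow> s \<le> r \<Longrightarrow> safe s x"
  by (induction r) (auto simp: le_Suc_eq simp del: safe.simps dest: safe_Suc_imp)

lemma \<epsilon>_pos: "0 < \<epsilon>" and \<epsilon>_le: "\<epsilon> \<le> \<eta>" and \<epsilon>_less_1: "\<epsilon> < 1"
proof -
  have "\<eta>\<^sup>2 \<le> \<eta>"
    using \<eta>_pos \<eta>_less_1 by (simp add: power2_eq_square mult_left_le)
  then show "0 < \<epsilon>" "\<epsilon> \<le> \<eta>" "\<epsilon> < 1"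
    using \<eta>_pos \<eta>_less_1 by (auto simp: \<epsilon>_def)
qed

lemma ratio_pos: "h x > 0 \<Longrightarrow> h y > 0 \<Longrightarrow> ratio x y > 0"
  using q_ge_2 by (simp add: ratio_def)

text \<open>The inequality at \<open>x\<close> is multiplied by \<open>sqrt q / h x\<close>; the
  term of the predecessor \<open>p\<close> then becomes \<open>q / ratio p x\<close>.\<close>

lemma sum_ratio_le:
  assumes "x \<in> N p" "h p > 0" "safe (Suc r) x"
  shows "(\<Sum>y\<in>N x - {p}. ratio x y) \<le> q * (2 + \<epsilon> - 1 / ratio p x)"
proof -
  have hx: "h x > 0" and le: "(\<Sum>y\<in>N x. h y) \<le> sqrt q * (2 + \<epsilon>) * h x"
    using assms(3) by auto
  have "(\<Sum>y\<in>N x. h y) = h p + (\<Sum>y\<in>N x - {p}. h y)"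
    using sym_N[OF assms(1)] finite_N by (simp add: sum.remove)
  with le have *: "(\<Sum>y\<in>N x - {p}. h y) \<le> sqrt q * (2 + \<epsilon>) * h x - h p" by simp
  have "(\<Sum>y\<in>N x - {p}. ratio x y) = sqrt q / h x * (\<Sum>y\<in>N x - {p}. h y)"
    by (simp add: ratio_def sum_distrib_left)
  also have "\<dots> \<le> sqrt q / h x * (sqrt q * (2 + \<epsilon>) * h x - h p)"
    using * hx by (intro mult_left_mono) auto
  also have "\<dots> = (sqrt q * sqrt q) * (2 + \<epsilon>) - sqrt q * h p / h x"
    using hx by (simp add: field_simps)
  also have "sqrt q * h p / h x = (sqrt q * sqrt q) * (1 / ratio p x)"
    using hx assms(2) q_ge_2 by (simp add: ratio_def field_simps)
  finally show ?thesis by (simp add: algebra_simps)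
qed

lemma card_N_remove:
  assumes "x \<in> N p" "x \<in> V"
  shows "q \<le> card (N x - {p})"
  using card_N[OF assms(2)] sym_N[OF assms(1)] by simp

text \<open>At least \<open>q\<close> forward ratios share the total from
  \<open>sum_ratio_le\<close>, so one of them is at most the average.\<close>

lemma exists_small_ratio:
  assumes "x \<in> N p" "h p > 0" "safe (Suc r) x"
  shows "\<exists>y \<in> N x - {p}. ratio x y \<le> 2 + \<epsilon> - 1 / ratio p x"
proof (rule ccontr)
  define t where "t = 2 + \<epsilon> - 1 / ratio p x"
  assume "\<not> ?thesis"
  then have gt: "ratio x y > t" if "y \<in> N x - {p}" for y
    using that by (force simp: t_def)
  have q: "q \<le> card (N x - {p})" using card_N_remove assms by auto
  then have ne: "N x - {p} \<noteq> {}" using q_ge_2 by (metis card.empty not_numeral_le_zero order_trans)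
  have pos: "ratio x y > 0" if "y \<in> N x" for y
    using assms(3) that safe_pos by (intro ratio_pos) auto
  have le: "(\<Sum>y\<in>N x - {p}. ratio x y) \<le> q * t"
    unfolding t_def using sum_ratio_le assms by blast
  \<comment> \<open>There may be more than \<open>q\<close> forward neighbours, so replacing
    \<open>q * t\<close> by their number times \<open>t\<close> requires
    \<open>t > 0\<close>.\<close>
  have "0 < (\<Sum>y\<in>N x - {p}. ratio x y)"
    using ne finite_N pos by (intro sum_pos) auto
  with le have "0 < real q * t" by linarith
  then have "0 < t" using q_ge_2 by (simp add: zero_less_mult_iff)
  then have "q * t \<le> card (N x - {p}) * t" using q by simp
  also have "\<dots> = (\<Sum>y\<in>N x - {p}. t)" by simp
  also have "\<dots> < (\<Sum>y\<in>N x - {p}. ratio x y)"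
    using ne finite_N gt by (intro sum_strict_mono) auto
  finally show False using le by simp
qed

text \<open>Multiplying out leaves \<open>2 * \<epsilon> * u \<le> (u - 1)\<^sup>2\<close>. For u at
  most 1 the left side is at most half of \<open>\<eta>\<^sup>2\<close>; for u = 1 + w it is half of
  \<open>\<eta>\<^sup>2 + \<eta>\<^sup>2 * w\<close>, where both summands are at most
  \<open>w\<^sup>2\<close>.\<close>

lemma ratio_bound_decrease:
  fixes u :: real
  assumes "u > 0" "\<bar>u - 1\<bar> > \<eta>"
  shows "2 + \<epsilon> - 1 / u \<le> u - \<epsilon>"
proof -
  have "2 * \<epsilon> * u \<le> (u - 1)\<^sup>2"
  proof (cases "u \<le> 1")
    case True
    have "\<eta>\<^sup>2 \<le> \<bar>u - 1\<bar>\<^sup>2" using assms \<eta>_pos by (intro power_mono) auto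
    moreover have "2 * \<epsilon> * u \<le> 2 * \<epsilon> * 1" using True \<epsilon>_pos by (intro mult_left_mono) auto
    moreover have "0 \<le> \<eta>\<^sup>2" by simp
    ultimately show ?thesis unfolding \<epsilon>_def power2_abs by linarith
  next
    case False
    define w where "w = u - 1"
    have w: "w > \<eta>" "u = 1 + w" using False assms by (auto simp: w_def)
    have "2 * \<epsilon> * u = \<eta> * \<eta> / 2 + \<eta> * \<eta> * w / 2"
      unfolding \<epsilon>_def w by (simp add: power2_eq_square algebra_simps)
    moreover have "\<eta> * \<eta> \<le> w * w" using w \<eta>_pos by (intro mult_mono) auto
    moreover have "\<eta> * \<eta> * w \<le> 1 * w * w"
      using w \<eta>_pos \<eta>_less_1 by (intro mult_right_mono mult_mono) auto
    ultimately show ?thesis by (simp add: w power2_eq_square)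
  qed
  then have "2 * \<epsilon> \<le> (u - 1)\<^sup>2 / u" using assms by (simp add: field_simps)
  also have "\<dots> = u - 2 + 1 / u" using assms by (simp add: field_simps power2_eq_square)
  finally show ?thesis by simp
qed

lemma ratio_descent:
  assumes "x \<in> N p" "h p > 0" "safe (Suc r) x" "\<bar>ratio p x - 1\<bar> > \<eta>"
  shows "\<exists>y \<in> N x - {p}. ratio x y \<le> ratio p x - \<epsilon>"
proof -
  have "ratio p x > 0" using assms(2,3) by (simp add: ratio_pos)
  from ratio_bound_decrease[OF this assms(4)] exists_small_ratio[OF assms(1-3)] show ?thesis
    by (meson order_trans)
qed

text \<open>Below \<open>1 - \<eta>\<close> the ratio loses at least \<epsilon> per step of
  \<open>ratio_descent\<close>, yet it is still positive after \<open>r\<close> steps.\<close>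

lemma small_ratio_gt:
  assumes "x \<in> N p" "h p > 0" "safe r x" "ratio p x < 1 - \<eta>"
  shows "ratio p x > r * \<epsilon>"
  using assms
proof (induction r arbitrary: p x)
  case 0
  then show ?case using ratio_pos by simp
next
  case (Suc r)
  have "\<bar>ratio p x - 1\<bar> > \<eta>" using Suc.prems(4) by linarith
  then obtain y where y: "y \<in> N x - {p}" "ratio x y \<le> ratio p x - \<epsilon>"
    using ratio_descent[OF Suc.prems(1-3)] by blast
  have "ratio x y > r * \<epsilon>"
    using Suc.prems y \<epsilon>_pos by (intro Suc.IH) auto
  then show ?case using y by (simp add: algebra_simps)
qed

lemma ratio_ge:
  assumes "x \<in> N p" "h p > 0" "safe r x" "1 \<le> r * \<epsilon>"
  shows "ratio p x \<ge> 1 - \<eta>"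
  using small_ratio_gt[OF assms(1-3)] assms(4) \<eta>_pos by linarith

text \<open>A ratio above \<open>1 + \<eta>\<close> drops by at least \<epsilon> per step, so
  \<open>K\<close> steps suffice, and radius \<open>r\<close> is kept in reserve.\<close>

lemma exists_ratio_near_1:
  assumes "x \<in> N p" "h p > 0" "safe (K + r) x" "ratio p x \<le> 1 + \<eta> + K * \<epsilon>" "1 \<le> r * \<epsilon>"
  shows "\<exists>p x. x \<in> N p \<and> h p > 0 \<and> safe r x \<and> ratio p x \<le> 1 + \<eta>"
  using assms
proof (induction K arbitrary: p x)
  case 0
  then show ?case by auto
next
  case (Suc K)
  show ?case
  proof (cases "ratio p x \<le> 1 + \<eta>")
    case True
    moreover have "safe r x" using Suc.prems(3) by (rule safe_mono) simp
    ultimately show ?thesis using Suc.prems by blast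
  next
    case False
    then have "\<bar>ratio p x - 1\<bar> > \<eta>" by linarith
    then obtain y where y: "y \<in> N x - {p}" "ratio x y \<le> ratio p x - \<epsilon>"
      using ratio_descent[of x p "K + r"] Suc.prems by (metis add_Suc)
    show ?thesis
      using Suc.prems y by (intro Suc.IH[of y x]) (auto simp: algebra_simps)
  qed
qed

text \<open>The other forward ratios are at least \<open>1 - \<eta>\<close> by
  \<open>ratio_ge\<close>, so the bound on the total caps the remaining one. The factor 3 collects
  three errors of at most \<open>q * a * \<eta>\<close> each: from \<epsilon>, from those lower
  bounds, and from \<open>ratio p x\<close> exceeding 1.\<close>

lemma next_ratio_le:
  fixes a :: real
  assumes "x \<in> N p" "h p > 0" "safe (Suc r) x" "1 \<le> r * \<epsilon>" "y \<in> N x" "y \<noteq> p"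
    and le: "ratio p x \<le> 1 + a * \<eta>" and a: "1 \<le> a"
  shows "ratio x y \<le> 1 + 3 * real q * a * \<eta>"
proof -
  let ?u = "ratio p x"
  have hx: "h x > 0" "x \<in> V" using assms(3) by auto
  have u: "?u > 0" using assms(2) hx by (simp add: ratio_pos)
  have yN: "y \<in> N x - {p}" using assms by auto
  have q: "q \<le> card (N x - {p})" using card_N_remove assms(1) hx by auto
  have cc: "card (N x - {p}) - 1 = card (N x - {p} - {y})" using yN finite_N by simp
  have "(real q - 1) * (1 - \<eta>) \<le> card (N x - {p} - {y}) * (1 - \<eta>)"
    using q cc \<eta>_less_1 q_ge_2 by (intro mult_right_mono) linarith+
  also have "\<dots> = (\<Sum>z\<in>N x - {p} - {y}. 1 - \<eta>)" by simp
  also have "\<dots> \<le> (\<Sum>z\<in>N x - {p} - {y}. ratio x z)"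
    using assms hx by (intro sum_mono ratio_ge[where r = r]) auto
  finally have "(real q - 1) * (1 - \<eta>) + ratio x y \<le> (\<Sum>z\<in>N x - {p}. ratio x z)"
    using yN finite_N by (subst sum.remove[of _ y]) auto
  also have "\<dots> \<le> q * (2 + \<epsilon> - 1 / ?u)" using sum_ratio_le assms by blast
  finally have *: "ratio x y \<le> 1 + q * \<epsilon> + (real q - 1) * \<eta> + q * (1 - 1 / ?u)"
    by (simp add: algebra_simps)
  have "1 - 1 / ?u \<le> ?u - 1"
  proof -
    have "(?u - 1)\<^sup>2 / ?u \<ge> 0" using u by simp
    moreover have "(?u - 1)\<^sup>2 / ?u = ?u - 2 + 1 / ?u"
      using u by (simp add: field_simps power2_eq_square)
    ultimately show ?thesis by linarith
  qed
  then have "q * (1 - 1 / ?u) \<le> q * (a * \<eta>)" using le by (intro mult_left_mono) auto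
  moreover have "q * \<epsilon> \<le> q * (a * \<eta>)" "q * \<eta> \<le> q * (a * \<eta>)"
  proof -
    have "\<eta> \<le> a * \<eta>" using a \<eta>_pos by simp
    then show "q * \<eta> \<le> q * (a * \<eta>)" "q * \<epsilon> \<le> q * (a * \<eta>)"
      using \<epsilon>_le by (auto intro!: mult_left_mono)
  qed
  moreover have "(real q - 1) * \<eta> \<le> q * \<eta>" using \<eta>_pos by simp
  moreover have "3 * real q * a * \<eta> = 3 * (q * (a * \<eta>))" by simp
  ultimately show ?thesis using * by linarith
qed

text \<open>Each use of \<open>next_ratio_le\<close> multiplies the error by \<open>3 * q\<close>
  and costs one unit of radius; \<open>r\<close> is the reserve needed for
  \<open>ratio_ge\<close>.\<close>

lemma ratio_along_walk:
  assumes "x \<in> N p" "h p > 0" "safe (Suc k + r) x" "1 \<le> r * \<epsilon>" "ratio p x \<le> 1 + \<eta>"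
    and c: "c 0 = x" "c 1 \<noteq> p" "\<And>i. c (Suc i) \<in> N (c i)" "\<And>i. c (Suc (Suc i)) \<noteq> c i"
    and "i \<le> k"
  shows "safe (Suc (k - i) + r) (c i) \<and> ratio (c i) (c (Suc i)) \<le> 1 + (3 * real q) ^ Suc i * \<eta>"
  using \<open>i \<le> k\<close>
proof (induction i)
  case 0
  have "safe (Suc r) x" "safe (Suc k + r) x" using assms(3) by (auto intro: safe_mono simp del: safe.simps)
  then show ?case
    using next_ratio_le[of x p r "c 1" 1] assms(1-5) c(1,2) c(3)[of 0] by (simp del: safe.simps)
next
  case (Suc i)
  have s: "safe (Suc (k - i) + r) (c i)" and le: "ratio (c i) (c (Suc i)) \<le> 1 + (3 * real q) ^ Suc i * \<eta>"
    using Suc by auto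
  have eq: "Suc (k - i) + r = Suc (Suc (k - Suc i) + r)" using Suc.prems by simp
  have s1: "safe (Suc (k - Suc i) + r) (c (Suc i))"
    using s c(3)[of i] unfolding eq safe.simps(2)[of "Suc (k - Suc i) + r"] by blast
  have s2: "safe (Suc r) (c (Suc i))" using s1 by (rule safe_mono) simp
  have "(1::real) \<le> (3 * real q) ^ Suc i" using q_ge_2 by (intro one_le_power) simp
  then have "ratio (c (Suc i)) (c (Suc (Suc i))) \<le> 1 + 3 * real q * (3 * real q) ^ Suc i * \<eta>"
    using s2 assms(4) c(3,4) safe_pos[OF s] le
    by (intro next_ratio_le[where p = "c i" and r = r]) (auto simp del: safe.simps)
  with s1 show ?case by (simp del: safe.simps)
qed

text \<open>If all ratios along the walk were small, \<open>h\<close> would strictly decrease around the cycle.\<close>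

lemma no_closed_walk:
  assumes "x \<in> N p" "h p > 0" "safe (Suc k + r) x" "1 \<le> r * \<epsilon>" "ratio p x \<le> 1 + \<eta>"
    and c: "c 0 = x" "c 1 \<noteq> p" "\<And>i. c (Suc i) \<in> N (c i)" "\<And>i. c (Suc (Suc i)) \<noteq> c i"
    and k: "0 < k" "c k = x" and \<eta>: "3 * (3 * real q) ^ k * \<eta> \<le> 1"
  shows False
proof -
  have dec: "h (c (Suc i)) < h (c i)" if "i < k" for i
  proof -
    have *: "safe (Suc (k - i) + r) (c i)" and u: "ratio (c i) (c (Suc i)) \<le> 1 + (3 * real q) ^ Suc i * \<eta>"
      using ratio_along_walk[where c = c and i = i, OF assms(1-5) c] that by (auto simp del: safe.simps)
    have "(3 * real q) ^ Suc i * \<eta> \<le> (3 * real q) ^ k * \<eta>"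
      using that q_ge_2 \<eta>_pos by (intro mult_right_mono power_increasing) auto
    \<comment> \<open>The condition on \<eta> limits the error to 1/3, and 16/9 < 2. A ratio below
      \<open>sqrt q\<close> says exactly that \<open>h\<close> decreases.\<close>
    then have "ratio (c i) (c (Suc i)) \<le> 4 / 3" using u \<eta> by simp
    also have "\<dots> < sqrt q"
      using q_ge_2 by (intro real_less_rsqrt) (simp add: power2_eq_square)
    finally show ?thesis
      using safe_pos[OF *(1)] q_ge_2 by (simp add: ratio_def divide_simps)
  qed
  have "i < k \<Longrightarrow> h (c (Suc i)) < h (c 0)" for i
    by (induction i) (use dec in fastforce)+
  from this[of "k - 1"] show False using k c(1) by simp
qed

text \<open>Indexing by integers lets the walk be reversed from the same start by negating the
  index.\<close>

definition closed_nb_walk :: "nat \<Rightarrow> (int \<Rightarrow> 'a) \<Rightarrow> bool" where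
  "closed_nb_walk k c \<longleftrightarrow> (\<forall>i. c (i + 1) \<in> N (c i)) \<and> (\<forall>i. c (i + 2) \<noteq> c i) \<and> (\<forall>i. c (i + int k) = c i)"

text \<open>The radius is spent on one step to a first edge, \<open>K\<close> steps to bring its
  ratio from at most \<open>3 * q\<close> close to 1, \<open>Suc k\<close> for the closed walk, and
  \<open>r\<close> for the lower bounds on ratios.\<close>

lemma not_safe:
  assumes nb: "\<And>x. x \<in> V \<Longrightarrow> \<exists>c. c 0 = x \<and> closed_nb_walk k c"
    and k: "0 < k" "3 * (3 * real q) ^ k * \<eta> \<le> 1"
    and K: "3 * real q \<le> K * \<epsilon>" and r: "1 \<le> r * \<epsilon>"
  shows "\<not> safe (Suc (K + (Suc k + r))) v"
proof
  assume s: "safe (Suc (K + (Suc k + r))) v"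
  then have "N v \<noteq> {}" using card_N[of v] by auto
  then obtain y where y: "y \<in> N v" by blast
  have sy: "safe (K + (Suc k + r)) y" and hv: "h v > 0" using s y by auto
  have hN: "h z > 0" if "z \<in> N v" for z using s that safe_pos by auto
  have "h y \<le> (\<Sum>z\<in>N v. h z)"
    using y finite_N hN by (intro member_le_sum) (auto simp: less_imp_le)
  also have "\<dots> \<le> sqrt q * (2 + \<epsilon>) * h v" using s by simp
  finally have "sqrt q * h y \<le> sqrt q * (sqrt q * (2 + \<epsilon>) * h v)" by (rule mult_left_mono) simp
  also have "\<dots> = (sqrt q * sqrt q) * ((2 + \<epsilon>) * h v)" by (simp only: mult_ac)
  finally have "ratio v y \<le> q * (2 + \<epsilon>)"
    using hv by (simp add: ratio_def field_simps)
  also have "\<dots> \<le> real q * 3" using \<epsilon>_less_1 by (intro mult_left_mono) auto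
  finally have "ratio v y \<le> 1 + \<eta> + K * \<epsilon>" using K \<eta>_pos by simp
  moreover have "1 \<le> (Suc k + r) * \<epsilon>"
    using r \<epsilon>_pos by (smt (verit) mult_right_mono of_nat_mono le_add2)
  ultimately obtain p x where px: "x \<in> N p" "h p > 0" "safe (Suc k + r) x" "ratio p x \<le> 1 + \<eta>"
    using exists_ratio_near_1[OF y hv sy] by blast
  have "x \<in> V" using px(3) by simp
  then obtain c where c0: "c 0 = x" and c: "\<And>i. c (i + 1) \<in> N (c i)" "\<And>i. c (i + 2) \<noteq> c i"
      "\<And>i. c (i + int k) = c i"
    using nb unfolding closed_nb_walk_def by blast
  show False
  \<comment> \<open>If the walk starts by returning to \<open>p\<close>, then \<open>c (-1)\<close>
    differs from \<open>p\<close> and the reversed walk is used.\<close>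
  proof (cases "c 1 = p")
    case False
    show False
    proof (rule no_closed_walk[OF px(1-3) r px(4), where c = "\<lambda>i. c (int i)"])
      show "c (int (Suc i)) \<in> N (c (int i))" for i using c(1)[of "int i"] by (simp add: add.commute)
      show "c (int (Suc (Suc i))) \<noteq> c (int i)" for i using c(2)[of "int i"] by (simp add: add.commute)
      show "c (int k) = x" using c(3)[of 0] c0 by simp
    qed (use False c0 k in auto)
  next
    case True
    show False
    proof (rule no_closed_walk[OF px(1-3) r px(4), where c = "\<lambda>i. c (- int i)"])
      show "c (- int 1) \<noteq> p" using c(2)[of "-1"] True by auto
      show "c (- int (Suc i)) \<in> N (c (- int i))" for i
        using c(1)[of "- int (Suc i)"] sym_N by simp
      show "c (- int (Suc (Suc i))) \<noteq> c (- int i)" for i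
        using c(2)[of "- int (Suc (Suc i))"] by auto
      show "c (- int k) = x" using c(3)[of "- int k"] c0 by simp
    qed (use c0 k in auto)
  qed
qed

end

section \<open>Traces and eigenvalues of symmetric matrices\<close>

definition mat_trace :: "'a :: comm_ring_1 mat \<Rightarrow> 'a" where
  "mat_trace A = (\<Sum>i<dim_row A. A $$ (i, i))"

lemma index_mat_mult_sum:
  assumes "A \<in> carrier_mat n n" "B \<in> carrier_mat n n" "i < n" "j < n"
  shows "(A * B) $$ (i, j) = (\<Sum>k<n. A $$ (i, k) * B $$ (k, j))"
  using assms by (auto simp: scalar_prod_def lessThan_atLeast0 intro!: sum.cong)

lemma mat_trace_mult_commute:
  assumes "A \<in> carrier_mat n n" "B \<in> carrier_mat n n"
  shows "mat_trace (A * B) = mat_trace (B * A)"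
proof -
  have "mat_trace (A * B) = (\<Sum>i<n. \<Sum>k<n. A $$ (i, k) * B $$ (k, i))"
    using assms by (simp add: mat_trace_def index_mat_mult_sum del: index_mult_mat(1))
  also have "\<dots> = (\<Sum>k<n. \<Sum>i<n. B $$ (k, i) * A $$ (i, k))"
    by (subst sum.swap) (simp add: mult.commute)
  also have "\<dots> = mat_trace (B * A)"
    using assms by (simp add: mat_trace_def index_mat_mult_sum del: index_mult_mat(1))
  finally show ?thesis .
qed

lemma mat_trace_similar:
  assumes "similar_mat_wit A B P Q"
  shows "mat_trace A = mat_trace B"
proof -
  note * = similar_mat_witD[OF refl assms]
  have "mat_trace A = mat_trace (Q * (P * B))"
    using * by (metis mat_trace_mult_commute mult_carrier_mat)
  also have "Q * (P * B) = (Q * P) * B" by (rule assoc_mult_mat[OF *(7) *(6) *(5), symmetric])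
  also have "\<dots> = B" unfolding *(2) using *(5) by simp
  finally show ?thesis .
qed

lemma upper_triangular_mult:
  assumes "A \<in> carrier_mat n n" "B \<in> carrier_mat n n" "upper_triangular A" "upper_triangular B"
  shows "upper_triangular (A * B)"
proof
  fix i j assume ij: "j < i" "i < dim_row (A * B)"
  have "A $$ (i, k) * B $$ (k, j) = 0" if "k < n" for k
    using that ij assms by (cases "k < i") (auto simp: upper_triangular_def)
  then show "(A * B) $$ (i, j) = 0"
    using ij assms by (subst index_mat_mult_sum[of _ n]) auto
qed

lemma upper_triangular_pow:
  assumes "A \<in> carrier_mat n n" "upper_triangular A"
  shows "upper_triangular (A ^\<^sub>m m)"
  using assms by (induction m) (auto intro: upper_triangular_mult[of _ n])

lemma upper_triangular_pow_diag:
  assumes A: "A \<in> carrier_mat n n" "upper_triangular A" and i: "i < n"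
  shows "(A ^\<^sub>m m) $$ (i, i) = A $$ (i, i) ^ m"
proof (induction m)
  case 0
  then show ?case using assms by simp
next
  case (Suc m)
  have ut: "upper_triangular (A ^\<^sub>m m)" using A by (rule upper_triangular_pow)
  have z: "(A ^\<^sub>m m) $$ (i, k) * A $$ (k, i) = 0" if "k \<in> {..<n} - {i}" for k
    using that A i ut by (cases "k < i") (auto simp: upper_triangular_def)
  have "(A ^\<^sub>m Suc m) $$ (i, i) = (\<Sum>k<n. (A ^\<^sub>m m) $$ (i, k) * A $$ (k, i))"
    using A i by (simp add: index_mat_mult_sum[of _ n] del: index_mult_mat(1))
  also have "\<dots> = (A ^\<^sub>m m) $$ (i, i) * A $$ (i, i)"
    using i z by (subst sum.remove[of _ i]) (auto intro!: sum.neutral)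
  finally show ?case by (simp only: Suc power_Suc2)
qed

text \<open>\<open>char_matrix A t\<close> is A - t I. Since the characteristic polynomial splits, a
  Schur decomposition makes A similar to a triangular matrix with diagonal \<open>es\<close>, where
  the trace of a power can be read off.\<close>

lemma mat_trace_pow_char_matrix:
  fixes A :: "real mat"
  assumes A: "A \<in> carrier_mat n n" and es: "char_poly A = (\<Prod>e\<leftarrow>es. [:- e, 1:])"
  shows "mat_trace (char_matrix A t ^\<^sub>m m) = (\<Sum>e\<leftarrow>es. (e - t) ^ m)"
proof -
  obtain B P Q where B: "schur_decomposition A es = (B, P, Q)" by (cases "schur_decomposition A es")
  from schur_decomposition[OF A es B] have wit: "similar_mat_wit A B P Q"
    and ut: "upper_triangular B" and diag: "diag_mat B = es" by auto
  have Bc: "B \<in> carrier_mat n n" using similar_mat_witD2[OF A wit] by auto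
  let ?T = "char_matrix B t"
  have T: "?T \<in> carrier_mat n n" using Bc by simp
  have utT: "upper_triangular ?T"
    using ut Bc by (auto simp: upper_triangular_def char_matrix_def)
  have "mat_trace (char_matrix A t ^\<^sub>m m) = mat_trace (?T ^\<^sub>m m)"
    using similar_mat_wit_pow[OF similar_mat_wit_char_matrix[OF wit]] by (rule mat_trace_similar)
  also have "\<dots> = (\<Sum>i<n. (B $$ (i, i) - t) ^ m)"
  proof -
    have "?T $$ (i, i) = B $$ (i, i) - t" if "i < n" for i
      using that Bc by (simp add: char_matrix_def)
    then show ?thesis
      unfolding mat_trace_def using T by (auto simp: upper_triangular_pow_diag[OF T utT] intro!: sum.cong)
  qed
  also have "\<dots> = (\<Sum>e\<leftarrow>diag_mat B. (e - t) ^ m)"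
    using Bc by (simp add: diag_mat_def sum_list_sum_nth lessThan_atLeast0)
  finally show ?thesis using diag by simp
qed

lemma symmetric_eigenvalue_real:
  fixes A :: "real mat"
  assumes A: "A \<in> carrier_mat n n" and sym: "\<And>i j. i < n \<Longrightarrow> j < n \<Longrightarrow> A $$ (i, j) = A $$ (j, i)"
    and ev: "eigenvalue (map_mat complex_of_real A) a"
  shows "a \<in> \<real>"
proof -
  obtain v where v: "v \<in> carrier_vec n" "v \<noteq> 0\<^sub>v n" "map_mat complex_of_real A *\<^sub>v v = a \<cdot>\<^sub>v v"
    using ev A unfolding eigenvalue_def eigenvector_def by auto
  have row: "(\<Sum>j<n. of_real (A $$ (i, j)) * v $ j) = a * v $ i" if "i < n" for i
  proof -
    have "(map_mat complex_of_real A *\<^sub>v v) $ i = (a \<cdot>\<^sub>v v) $ i" using v by simp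
    then show ?thesis using that A v(1) by (simp add: scalar_prod_def lessThan_atLeast0)
  qed
  \<comment> \<open>The form v* A v is real by symmetry and equals \<open>a\<close> times the
    squared norm of \<open>v\<close>.\<close>
  define S where "S = (\<Sum>i<n. \<Sum>j<n. cnj (v $ i) * of_real (A $$ (i, j)) * v $ j)"
  have "cnj S = (\<Sum>i<n. \<Sum>j<n. cnj (v $ j) * of_real (A $$ (i, j)) * v $ i)"
    by (simp add: S_def mult_ac)
  also have "\<dots> = (\<Sum>i<n. \<Sum>j<n. cnj (v $ j) * of_real (A $$ (j, i)) * v $ i)"
    by (intro sum.cong refl) (simp add: sym)
  also have "\<dots> = S" unfolding S_def by (rule sum.swap)
  finally have real: "cnj S = S" .
  have "S = (\<Sum>i<n. cnj (v $ i) * (\<Sum>j<n. of_real (A $$ (i, j)) * v $ j))"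
    by (simp add: S_def sum_distrib_left mult.assoc)
  also have "\<dots> = (\<Sum>i<n. cnj (v $ i) * (a * v $ i))" by (simp add: row)
  also have "\<dots> = a * of_real (\<Sum>i<n. (cmod (v $ i))\<^sup>2)"
    by (simp add: sum_distrib_left complex_norm_square mult_ac del: of_real_power)
  finally have S: "S = a * of_real (\<Sum>i<n. (cmod (v $ i))\<^sup>2)" .
  obtain i where "i < n" "v $ i \<noteq> 0" using v by force
  then have "(\<Sum>i<n. (cmod (v $ i))\<^sup>2) > 0" by (intro sum_pos2[of _ i]) auto
  moreover have "cnj S = cnj a * of_real (\<Sum>i<n. (cmod (v $ i))\<^sup>2)"
    unfolding S by (simp only: complex_cnj_mult complex_cnj_complex_of_real)
  ultimately have "cnj a = a" using real S by (metis less_irrefl mult_right_cancel of_real_eq_0_iff)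
  then show ?thesis by (simp add: Reals_cnj_iff)
qed

text \<open>The complex roots are real, so the complex factorisation descends along the injective
  embedding of real polynomials.\<close>

lemma symmetric_char_poly_splits:
  fixes A :: "real mat"
  assumes A: "A \<in> carrier_mat n n" and sym: "\<And>i j. i < n \<Longrightarrow> j < n \<Longrightarrow> A $$ (i, j) = A $$ (j, i)"
  shows "\<exists>es. char_poly A = (\<Prod>e\<leftarrow>es. [:- e, 1:]) \<and> length es = n"
proof -
  let ?A = "map_mat complex_of_real A"
  interpret P: map_poly_inj_comm_ring_hom complex_of_real ..
  have A': "?A \<in> carrier_mat n n" using A by simp
  obtain as where as: "char_poly ?A = (\<Prod>a\<leftarrow>as. [:- a, 1:])" "length as = n"
    using char_poly_factorized[OF A'] by blast
  have "a \<in> \<real>" if "a \<in> set as" for a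
  proof -
    have "poly (char_poly ?A) a = 0"
      unfolding as(1) poly_prod_list using that by (auto simp: prod_list_zero_iff)
    then show ?thesis
      using symmetric_eigenvalue_real[OF A sym] eigenvalue_root_char_poly[OF A'] by blast
  qed
  then have re: "map (complex_of_real \<circ> Re) as = as" by (intro map_idI) auto
  have "map_poly complex_of_real (char_poly A) = (\<Prod>a\<leftarrow>map (complex_of_real \<circ> Re) as. [:- a, 1:])"
    unfolding re using as(1) by (simp add: of_real_hom.char_poly_hom[OF A])
  also have "\<dots> = map_poly complex_of_real (\<Prod>e\<leftarrow>map Re as. [:- e, 1:])"
    by (simp add: P.hom_prod_list o_def)
  finally have "char_poly A = (\<Prod>e\<leftarrow>map Re as. [:- e, 1:])" by simp
  then show ?thesis using as(2) by (intro exI[of _ "map Re as"]) simp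
qed

text \<open>The eigenvalue equation is read at a coordinate of maximal modulus.\<close>

lemma abs_eigenvalue_le_row_sum:
  fixes A :: "real mat"
  assumes A: "A \<in> carrier_mat n n" and D: "\<And>i. i < n \<Longrightarrow> (\<Sum>j<n. \<bar>A $$ (i, j)\<bar>) \<le> D"
    and ev: "eigenvalue A e"
  shows "\<bar>e\<bar> \<le> D"
proof -
  obtain v where v: "v \<in> carrier_vec n" "v \<noteq> 0\<^sub>v n" "A *\<^sub>v v = e \<cdot>\<^sub>v v"
    using ev A unfolding eigenvalue_def eigenvector_def by auto
  obtain i where i: "i < n" "v $ i \<noteq> 0" using v by force
  obtain m where m: "m < n" and max: "\<And>j. j < n \<Longrightarrow> \<bar>v $ j\<bar> \<le> \<bar>v $ m\<bar>"
  proof -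
    have "Max ((\<lambda>j. \<bar>v $ j\<bar>) ` {..<n}) \<in> (\<lambda>j. \<bar>v $ j\<bar>) ` {..<n}" using i by (intro Max_in) auto
    then obtain m where "m < n" "Max ((\<lambda>j. \<bar>v $ j\<bar>) ` {..<n}) = \<bar>v $ m\<bar>" by auto
    then show ?thesis using that[of m] by (metis (no_types, lifting) Max_ge finite_imageI finite_lessThan image_eqI lessThan_iff)
  qed
  have "(A *\<^sub>v v) $ m = (e \<cdot>\<^sub>v v) $ m" using v by simp
  then have "e * v $ m = (\<Sum>j<n. A $$ (m, j) * v $ j)"
    using m A v(1) by (simp add: scalar_prod_def lessThan_atLeast0)
  then have "\<bar>e\<bar> * \<bar>v $ m\<bar> \<le> (\<Sum>j<n. \<bar>A $$ (m, j)\<bar> * \<bar>v $ j\<bar>)"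
    using sum_abs[of "\<lambda>j. A $$ (m, j) * v $ j" "{..<n}"] by (simp add: abs_mult[symmetric])
  also have "\<dots> \<le> (\<Sum>j<n. \<bar>A $$ (m, j)\<bar> * \<bar>v $ m\<bar>)"
    using max by (intro sum_mono mult_left_mono) auto
  also have "\<dots> \<le> D * \<bar>v $ m\<bar>"
    using D[OF m] by (simp add: sum_distrib_right[symmetric] mult_right_mono)
  finally have "\<bar>e\<bar> * \<bar>v $ m\<bar> \<le> D * \<bar>v $ m\<bar>" .
  moreover have "\<bar>v $ m\<bar> > 0" using max[OF i(1)] i(2) by linarith
  ultimately show ?thesis by simp
qed

lemma pow_mat_add:
  assumes "A \<in> carrier_mat n n"
  shows "A ^\<^sub>m (a + b) = A ^\<^sub>m a * A ^\<^sub>m b"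
proof (induction b)
  case (Suc b)
  then show ?case
    using assoc_mult_mat[OF pow_carrier_mat[OF assms, of a] pow_carrier_mat[OF assms, of b] assms] by simp
qed (use assms in simp)

lemma symmetric_pow:
  assumes A: "A \<in> carrier_mat n n" and sym: "A\<^sup>T = A"
  shows "(A ^\<^sub>m m)\<^sup>T = (A ^\<^sub>m m :: 'a :: comm_ring_1 mat)"
proof (induction m)
  case (Suc m)
  have "(A ^\<^sub>m Suc m)\<^sup>T = A\<^sup>T * (A ^\<^sub>m m)\<^sup>T"
    using A by (simp add: transpose_mult[of _ n n])
  also have "\<dots> = A ^\<^sub>m 1 * A ^\<^sub>m m" using A Suc sym by simp
  also have "\<dots> = A ^\<^sub>m Suc m" using pow_mat_add[OF A, of 1 m] by simp
  finally show ?case .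
qed (use A in simp)

text \<open>The right side is the sum of the squares of row \<open>i\<close> of the power
  \<open>m\<close>. This converts a large entry anywhere in the row into a large diagonal
  entry.\<close>

lemma symmetric_pow_diag_ge:
  fixes A :: "real mat"
  assumes A: "A \<in> carrier_mat n n" and sym: "A\<^sup>T = A" and "i < n" "j < n"
  shows "((A ^\<^sub>m m) $$ (i, j))\<^sup>2 \<le> (A ^\<^sub>m (2 * m)) $$ (i, i)"
proof -
  let ?B = "A ^\<^sub>m m"
  have B: "?B \<in> carrier_mat n n" using A by simp
  have "?B $$ (k, i) = ?B $$ (i, k)" if "k < n" for k
    using symmetric_pow[OF A sym, of m] B that \<open>i < n\<close> by (metis carrier_matD index_transpose_mat(1))
  then have "(?B * ?B) $$ (i, i) = (\<Sum>k<n. (?B $$ (i, k))\<^sup>2)"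
    using B \<open>i < n\<close> by (simp add: index_mat_mult_sum[of _ n] power2_eq_square del: index_mult_mat(1))
  moreover have "((A ^\<^sub>m m) $$ (i, j))\<^sup>2 \<le> (\<Sum>k<n. (?B $$ (i, k))\<^sup>2)"
    using \<open>j < n\<close> by (intro member_le_sum) auto
  ultimately show ?thesis using pow_mat_add[OF A, of m m] by (simp add: mult_2)
qed

text \<open>The shift makes every base nonnegative, so powers are monotone; entries above
  \<open>l\<close> are bounded through \<open>2 * D\<close>, the others through
  \<open>D + l\<close>.\<close>

lemma sum_list_shifted_power_le:
  fixes es :: "real list" and D l :: real
  assumes "\<And>e. e \<in> set es \<Longrightarrow> \<bar>e\<bar> \<le> D" and "0 \<le> l"
  shows "(\<Sum>e\<leftarrow>es. (e + D) ^ m)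
    \<le> length (filter (\<lambda>e. e > l) es) * (2 * D) ^ m + length es * (D + l) ^ m"
  using assms(1)
proof (induction es)
  case (Cons e es)
  have e: "0 \<le> e + D" "e \<le> D" "0 \<le> D" using Cons.prems[of e] by auto
  have IH: "(\<Sum>e\<leftarrow>es. (e + D) ^ m)
    \<le> length (filter (\<lambda>e. e > l) es) * (2 * D) ^ m + length es * (D + l) ^ m"
    using Cons by auto
  have "0 \<le> (D + l) ^ m" using e \<open>0 \<le> l\<close> by simp
  show ?case
  proof (cases "e > l")
    case True
    have "(e + D) ^ m \<le> (2 * D) ^ m" using e by (intro power_mono) auto
    then show ?thesis using IH True \<open>0 \<le> (D + l) ^ m\<close> by (simp add: distrib_right)
  next
    case False
    then have "(e + D) ^ m \<le> (D + l) ^ m" using e by (intro power_mono) auto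
    then show ?thesis using IH False by (simp add: distrib_right)
  qed
qed simp

section \<open>Green's functions\<close>

context superharmonic
begin

text \<open>\<open>P i\<close> is an invariant for points reached in \<open>i\<close> steps; it
  passes to neighbours, so local inequalities up to depth \<open>R\<close> combine into
  \<open>safe\<close>.\<close>

lemma safe_if_superharmonic:
  assumes closed: "\<And>x. x \<in> V \<Longrightarrow> N x \<subseteq> V"
    and P: "\<And>i x. i \<le> R \<Longrightarrow> x \<in> V \<Longrightarrow> P i x \<Longrightarrow>
      h x > 0 \<and> (\<Sum>y\<in>N x. h y) \<le> sqrt q * (2 + \<epsilon>) * h x \<and> (\<forall>y\<in>N x. P (Suc i) y)"
    and "i + r \<le> R" "x \<in> V" "P i x"
  shows "safe r x"
  using assms(3-5)
proof (induction r arbitrary: i x)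
  case 0
  then show ?case using P[of i x] by simp
next
  case (Suc r)
  have *: "h x > 0" "(\<Sum>y\<in>N x. h y) \<le> sqrt q * (2 + \<epsilon>) * h x" "\<And>y. y \<in> N x \<Longrightarrow> P (Suc i) y"
    using P[of i x] Suc.prems by auto
  have "safe r y" if "y \<in> N x" for y
    using Suc.IH[of "Suc i" y] Suc.prems * that closed by auto
  then show ?case using * Suc.prems by simp
qed


text \<open>Here \<open>h\<close> is the truncated Green's function of \<open>A + D\<close> at \<open>v\<close>, where \<open>A\<close> is the adjacency
  operator; the bound on \<open>P (Suc S)\<close> makes the truncation error negligible on the ball of radius \<open>R\<close>.\<close>

lemma safe_Green:
  fixes P :: "nat \<Rightarrow> 'a \<Rightarrow> real" and D \<mu> \<mu>' z :: real
  assumes closed: "\<And>x. x \<in> V \<Longrightarrow> N x \<subseteq> V" and v: "v \<in> V" and D: "0 \<le> D"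
    and P0: "\<And>x. x \<in> V \<Longrightarrow> P 0 x = (if x = v then 1 else 0)"
    and P_Suc: "\<And>i x. x \<in> V \<Longrightarrow> P (Suc i) x = D * P i x + (\<Sum>y\<in>N x. P i y)"
    and P_le: "\<And>x. x \<in> V \<Longrightarrow> P (Suc S) x \<le> \<mu> ^ Suc S"
    and \<mu>': "\<mu>' = D + sqrt q * (2 + 3 * \<eta>\<^sup>2 / 16)"
    and z: "0 < z" "z \<le> 1" "z * \<mu>' = 1"
    and S: "R \<le> S" "\<mu> * (\<mu> * z) ^ S < sqrt q * \<eta>\<^sup>2 / 16 * z ^ R"
    and h: "\<And>x. h x = (\<Sum>j\<le>S. z ^ j * P j x)"
  shows "safe R v"
proof -
  have P_nonneg: "x \<in> V \<Longrightarrow> P i x \<ge> 0" for i x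
  proof (induction i arbitrary: x)
    case (Suc i)
    then have "y \<in> N x \<Longrightarrow> P i y \<ge> 0" for y using closed by blast
    then show ?case using Suc D by (simp add: P_Suc sum_nonneg)
  qed (simp add: P0)
  \<comment> \<open>The single term with index \<open>i\<close> of \<open>h\<close> suffices,
    because \<open>z\<close> is at most 1.\<close>
  have h_ge: "h x \<ge> z ^ R" if "x \<in> V" "i \<le> R" "P i x \<ge> 1" for x i
  proof -
    have "z ^ R \<le> z ^ i * 1" using z that by (simp add: power_decreasing)
    also have "\<dots> \<le> z ^ i * P i x" using z that by (intro mult_left_mono) auto
    also have "\<dots> \<le> h x"
      unfolding h using z that S P_nonneg by (intro member_le_sum) auto
    finally show ?thesis .
  qed
  have h_sum: "(\<Sum>y\<in>N x. h y) \<le> (sqrt q * (2 + 3 * \<eta>\<^sup>2 / 16)) * h x + \<mu> * (\<mu> * z) ^ S"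
    if x: "x \<in> V" for x
  proof -
    have \<mu>'_nonneg: "0 \<le> \<mu>'" using D by (simp add: \<mu>')
    have "(\<Sum>y\<in>N x. h y) = (\<Sum>j\<le>S. \<Sum>y\<in>N x. z ^ j * P j y)"
      unfolding h by (rule sum.swap)
    \<comment> \<open>Applying A + D shifts the index of the series, and the factor
      \<open>z * \<mu>' = 1\<close> realigns the powers of \<open>z\<close>. This reproduces
      \<open>h\<close> up to a new last term and the nonnegative initial term \<open>P 0 x\<close>,
      which is dropped.\<close>
    then have "D * h x + (\<Sum>y\<in>N x. h y) = (\<Sum>j\<le>S. z ^ j * P (Suc j) x)"
      unfolding h[of x] P_Suc[OF x]
      by (simp add: sum_distrib_left distrib_left sum.distrib mult.left_commute)
    also have "\<dots> = (z * \<mu>') * (\<Sum>j\<le>S. z ^ j * P (Suc j) x)" using z by simp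
    also have "\<dots> = \<mu>' * (\<Sum>j\<le>S. z ^ Suc j * P (Suc j) x)"
      by (simp add: sum_distrib_left mult_ac)
    also have "(\<Sum>j\<le>S. z ^ Suc j * P (Suc j) x) = (\<Sum>j\<le>Suc S. z ^ j * P j x) - P 0 x"
      by (subst sum.atMost_Suc_shift) simp
    also have "\<dots> = h x + z ^ Suc S * P (Suc S) x - P 0 x" by (simp add: h)
    also have "\<mu>' * \<dots> \<le> \<mu>' * (h x + z ^ Suc S * P (Suc S) x)"
      using P_nonneg[OF x, of 0] \<mu>'_nonneg by (intro mult_left_mono) auto
    also have "\<dots> = \<mu>' * h x + (z * \<mu>') * (z ^ S * P (Suc S) x)"
      by (simp add: algebra_simps)
    also have "\<dots> = \<mu>' * h x + z ^ S * P (Suc S) x" using z by simp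
    also have "\<dots> \<le> \<mu>' * h x + z ^ S * \<mu> ^ Suc S"
      using P_le[OF x] z by (intro add_left_mono mult_left_mono) auto
    also have "z ^ S * \<mu> ^ Suc S = \<mu> * (\<mu> * z) ^ S" by (simp add: power_mult_distrib)
    finally show ?thesis unfolding \<mu>' by (simp add: distrib_right)
  qed
  show ?thesis
  proof (rule safe_if_superharmonic[where P = "\<lambda>i x. P i x \<ge> 1" and i = 0 and R = R])
    fix i x assume ix: "i \<le> R" "x \<in> V" "P i x \<ge> 1"
    have hx: "h x \<ge> z ^ R" using h_ge ix by blast
    have "z ^ R > 0" using z by simp
    with hx have "h x > 0" by linarith
    moreover have "(\<Sum>y\<in>N x. h y) \<le> sqrt q * (2 + \<epsilon>) * h x"
    proof -
      \<comment> \<open>The truncation error uses up the remaining slack: 3/16 + 1/16 is the 1/4 in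
        \<epsilon>.\<close>
      have "sqrt q * \<eta>\<^sup>2 / 16 * z ^ R \<le> sqrt q * \<eta>\<^sup>2 / 16 * h x"
        using hx by (intro mult_left_mono) auto
      then have "(\<Sum>y\<in>N x. h y) \<le> sqrt q * (2 + 3 * \<eta>\<^sup>2 / 16) * h x + sqrt q * \<eta>\<^sup>2 / 16 * h x"
        using h_sum[OF ix(2)] S(2) by linarith
      also have "\<dots> = sqrt q * (2 + \<epsilon>) * h x" by (simp add: \<epsilon>_def algebra_simps)
      finally show ?thesis .
    qed
    moreover have "P (Suc i) y \<ge> 1" if "y \<in> N x" for y
    proof -
      have y: "y \<in> V" "x \<in> N y" using that closed ix sym_N by auto
      have "P i x \<le> (\<Sum>x\<in>N y. P i x)"
        using y finite_N closed P_nonneg by (intro member_le_sum) blast+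
      moreover have "0 \<le> D * P i y" using D P_nonneg y by simp
      ultimately show ?thesis using ix by (simp add: P_Suc[OF y(1)])
    qed
    ultimately show "h x > 0 \<and> (\<Sum>y\<in>N x. h y) \<le> sqrt q * (2 + \<epsilon>) * h x \<and> (\<forall>y\<in>N x. P (Suc i) y \<ge> 1)"
      by blast
  qed (use closed v P0 in auto)
qed

end

text \<open>Here \<open>\<mu> * z\<close> is \<mu> / \<mu>' < 1, so the error decays
  geometrically.\<close>

lemma exists_truncation:
  fixes \<mu> \<mu>' z b :: real
  assumes "0 \<le> \<mu>" "\<mu> < \<mu>'" "z * \<mu>' = 1" "0 < b"
  obtains S where "R \<le> S" "\<mu> * (\<mu> * z) ^ S < b"
proof -
  have z: "z = 1 / \<mu>'" using assms by (auto simp: field_simps)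
  have "(\<lambda>S. \<mu> * (\<mu> * z) ^ S) \<longlonglongrightarrow> \<mu> * 0"
    using assms unfolding z by (intro tendsto_mult tendsto_const LIMSEQ_realpow_zero) auto
  moreover have "\<mu> * 0 < b" using assms by simp
  ultimately have "\<forall>\<^sub>F S in sequentially. \<mu> * (\<mu> * z) ^ S < b"
    by (rule order_tendstoD)
  then have "\<forall>\<^sub>F S in sequentially. R \<le> S \<and> \<mu> * (\<mu> * z) ^ S < b"
    using eventually_ge_at_top[of R] by eventually_elim auto
  then obtain S where "R \<le> S \<and> \<mu> * (\<mu> * z) ^ S < b"
    by (blast dest: eventually_happens'[OF sequentially_bot])
  then show ?thesis using that by blast
qed

section \<open>Retracting-free closed walks and universal girth\<close>

lemma nth_in_vwalk_arcs:
  "Suc i < length p \<Longrightarrow> (p ! i, p ! Suc i) \<in> set (vwalk_arcs p)"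
proof (induction p arbitrary: i rule: vwalk_arcs.induct)
  case (3 x y xs)
  then show ?case by (cases i) auto
qed auto

lemma closed_vwalk_arc:
  assumes "closed_vwalk G p" "i < length p"
  shows "(p ! i, p ! (Suc i mod length p)) \<in> parcs G"
proof -
  let ?q = "p @ [hd p]"
  have "(?q ! i, ?q ! Suc i) \<in> set (vwalk_arcs ?q)" using assms by (intro nth_in_vwalk_arcs) simp
  then have "(?q ! i, ?q ! Suc i) \<in> parcs G"
    using assms unfolding closed_vwalk_def vwalk_def by auto
  moreover have "?q ! Suc i = p ! (Suc i mod length p)"
  proof (cases "Suc i = length p")
    case True
    then show ?thesis using assms by (simp add: nth_append hd_conv_nth closed_vwalk_def)
  next
    case False
    then show ?thesis using assms by (simp add: nth_append)
  qed
  ultimately show ?thesis using assms by (simp add: nth_append)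
qed

lemma closed_nb_walk_of_list:
  assumes "superharmonic V N q \<eta>" and N: "\<And>x y. y \<in> N x \<longleftrightarrow> (x, y) \<in> parcs G"
    and p: "closed_vwalk G p" "retracting_free p"
  shows "superharmonic.closed_nb_walk N (length p) (\<lambda>i. p ! nat (i mod int (length p)))"
proof -
  \<comment> \<open>\<open>undefined\<close> fills the parameter \<open>h\<close>, on which
    \<open>closed_nb_walk\<close> does not depend.\<close>
  interpret superharmonic V N q undefined \<eta> by fact
  let ?k = "length p"
  have k: "?k > 0" using p by (simp add: closed_vwalk_def)
  have shift: "nat ((i + int a) mod int ?k) = (nat (i mod int ?k) + a) mod ?k" for i a
  proof -
    have "(i + int a) mod int ?k = int ((nat (i mod int ?k) + a) mod ?k)"
      using k by (simp add: zmod_int mod_add_left_eq)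
    then show ?thesis by simp
  qed
  have lt: "nat (i mod int ?k) < ?k" for i using k by (simp add: nat_less_iff)
  show ?thesis unfolding closed_nb_walk_def
  proof (intro conjI allI)
    fix i
    show "p ! nat ((i + 1) mod int ?k) \<in> N (p ! nat (i mod int ?k))"
      using closed_vwalk_arc[OF p(1) lt[of i]] shift[of i 1] by (simp add: N)
    show "p ! nat ((i + 2) mod int ?k) \<noteq> p ! nat (i mod int ?k)"
      using p(2) lt[of i] shift[of i 2] unfolding retracting_free_def by (metis of_nat_numeral)
  qed simp
qed

text \<open>A finite bound makes the set nonempty, and then its infimum in \<open>enat\<close> is
  attained.\<close>

lemma universal_girth_le_imp:
  assumes "universal_girth G \<le> enat g"
  obtains k where "0 < k" "k \<le> g"
    "\<And>v. v \<in> pverts G \<Longrightarrow> \<exists>p. closed_vwalk G p \<and> retracting_free p \<and> length p = k \<and> hd p = v"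
proof -
  define A where "A = {enat k | k. 0 < k \<and> (\<forall>v \<in> pverts G.
     \<exists>p. closed_vwalk G p \<and> retracting_free p \<and> length p = k \<and> hd p = v)}"
  have le: "Inf A \<le> enat g" using assms unfolding universal_girth_def A_def .
  then have "A \<noteq> {}" by (auto simp: Inf_enat_def)
  then have "Inf A \<in> A" unfolding Inf_enat_def by (auto intro: LeastI)
  then obtain k where "Inf A = enat k" "0 < k" "\<forall>v \<in> pverts G.
     \<exists>p. closed_vwalk G p \<and> retracting_free p \<and> length p = k \<and> hd p = v"
    unfolding A_def by blast
  then show ?thesis using that[of k] le by auto
qed

lemma out_degree_eq_card: "out_degree (with_proj G) v = card {y. (v, y) \<in> parcs G}"
proof -
  have "out_arcs (with_proj G) v = Pair v ` {y. (v, y) \<in> parcs G}"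
    by (auto simp: out_arcs_def)
  then show ?thesis by (simp add: out_degree_def card_image inj_on_def)
qed

section \<open>Adjacency matrices\<close>

locale adjacency =
  fixes G :: "nat pair_pre_digraph" and n d \<Delta> :: nat
  assumes graph: "pair_graph G" and verts: "pverts G = {0..<n}"
    and min_deg: "d \<le> min_degree G" and max_deg: "max_degree G \<le> \<Delta>"
begin

interpretation pair_graph G by (rule graph)

abbreviation (input) A :: "real mat" where "A \<equiv> adjacency_mat n G"

definition nbrs :: "nat \<Rightarrow> nat set" where "nbrs v = {y. (v, y) \<in> parcs G}"

lemma adjacency_carrier: "A \<in> carrier_mat n n"
  by (simp add: adjacency_mat_def)

lemma arc_sym: "(x, y) \<in> parcs G \<longleftrightarrow> (y, x) \<in> parcs G"
  using pair_sym_arcs by (auto simp: symmetric_def dest: symD)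

lemma nbrs_subset: "nbrs x \<subseteq> {..<n}"
  using in_arcsD2 verts by (auto simp: nbrs_def)

lemma finite_nbrs: "finite (nbrs x)"
  using nbrs_subset finite_subset by blast

lemma card_nbrs:
  assumes "v < n"
  shows "d \<le> card (nbrs v)" "card (nbrs v) \<le> \<Delta>"
proof -
  let ?D = "(\<lambda>v. out_degree (with_proj G) v) ` pverts G"
  have "card (nbrs v) \<in> ?D" using assms verts by (auto simp: nbrs_def out_degree_eq_card)
  moreover have "finite ?D" using verts by simp
  ultimately have "Min ?D \<le> card (nbrs v)" "card (nbrs v) \<le> Max ?D" by auto
  then show "d \<le> card (nbrs v)" "card (nbrs v) \<le> \<Delta>"
    using min_deg max_deg unfolding min_degree_def max_degree_def by auto
qed

lemma adjacency_index: "i < n \<Longrightarrow> j < n \<Longrightarrow> A $$ (i, j) = (if j \<in> nbrs i then 1 else 0)"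
  by (simp add: adjacency_mat_def nbrs_def)

lemma adjacency_symmetric: "i < n \<Longrightarrow> j < n \<Longrightarrow> A $$ (i, j) = A $$ (j, i)"
  using arc_sym by (simp add: adjacency_mat_def)

lemma sum_adjacency: "i < n \<Longrightarrow> (\<Sum>j<n. A $$ (i, j) * f j) = (\<Sum>j\<in>nbrs i. f j)"
  using nbrs_subset[of i]
  by (simp add: adjacency_index if_distrib[of "\<lambda>x. x * _"] sum.If_cases Int_absorb1 cong: if_cong)

lemma abs_eigenvalue_le:
  assumes "eigenvalue A e"
  shows "\<bar>e\<bar> \<le> \<Delta>"
proof (rule abs_eigenvalue_le_row_sum[OF adjacency_carrier _ assms])
  fix i assume i: "i < n"
  have "(\<Sum>j<n. \<bar>A $$ (i, j)\<bar>) = (\<Sum>j<n. A $$ (i, j) * 1)"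
    using i by (intro sum.cong) (auto simp: adjacency_index)
  also have "\<dots> = card (nbrs i)" using i by (simp only: sum_adjacency) simp
  finally show "(\<Sum>j<n. \<bar>A $$ (i, j)\<bar>) \<le> \<Delta>" using card_nbrs[OF i] by simp
qed

text \<open>Both sides estimate the trace of the power \<open>m\<close> of A + \<Delta>: from below
  by its diagonal, from above by its eigenvalues.\<close>

lemma count_eigenvalues_ge:
  fixes l \<mu> :: real
  assumes l: "0 \<le> l" and diag: "\<And>v. v < n \<Longrightarrow> \<mu> ^ m \<le> (char_matrix A (- \<Delta>) ^\<^sub>m m) $$ (v, v)"
  shows "n * (\<mu> ^ m - (\<Delta> + l) ^ m) \<le> size {#x \<in># eigenvalue_mset A. x > l#} * (2 * \<Delta>) ^ m"
proof -
  obtain es where es: "char_poly A = (\<Prod>e\<leftarrow>es. [:- e, 1:])" "length es = n"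
    using symmetric_char_poly_splits[OF adjacency_carrier adjacency_symmetric] by blast
  have mset: "eigenvalue_mset A = mset es"
  proof -
    have "proots (\<Prod>e\<leftarrow>es. [:- e, 1:]) = mset es"
    proof (induction es)
      case (Cons e es)
      have "(\<Prod>e\<leftarrow>es. [:- e, 1:]) \<noteq> 0" by (auto simp: prod_list_zero_iff)
      then show ?case using Cons by (simp add: proots_mult del: mult_pCons_left)
    qed simp
    then show ?thesis by (simp add: eigenvalue_mset_def es)
  qed
  have bound: "\<bar>e\<bar> \<le> \<Delta>" if "e \<in> set es" for e
  proof (rule abs_eigenvalue_le)
    have "poly (char_poly A) e = 0"
      unfolding es poly_prod_list using that by (auto simp: prod_list_zero_iff)
    then show "eigenvalue A e" using eigenvalue_root_char_poly[OF adjacency_carrier] by blast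
  qed
  have "n * \<mu> ^ m = (\<Sum>v<n. \<mu> ^ m)" by simp
  also have "\<dots> \<le> mat_trace (char_matrix A (- \<Delta>) ^\<^sub>m m)"
  proof -
    have "char_matrix A (- \<Delta>) \<in> carrier_mat n n" using adjacency_carrier by simp
    then have "mat_trace (char_matrix A (- \<Delta>) ^\<^sub>m m) = (\<Sum>v<n. (char_matrix A (- \<Delta>) ^\<^sub>m m) $$ (v, v))"
      unfolding mat_trace_def by (simp only: pow_mat_dim_square)
    also have "\<dots> \<ge> (\<Sum>v<n. \<mu> ^ m)" using diag by (intro sum_mono) auto
    finally show ?thesis .
  qed
  also have "\<dots> = (\<Sum>e\<leftarrow>es. (e + \<Delta>) ^ m)"
    using mat_trace_pow_char_matrix[OF adjacency_carrier es(1)] by simp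
  also have "\<dots> \<le> length (filter (\<lambda>e. e > l) es) * (2 * \<Delta>) ^ m + n * (\<Delta> + l) ^ m"
    using sum_list_shifted_power_le[of es \<Delta> l m] bound l es(2) by simp
  also have "length (filter (\<lambda>e. e > l) es) = size {#x \<in># eigenvalue_mset A. x > l#}"
    unfolding mset by (simp flip: size_mset)
  finally show ?thesis by (simp add: right_diff_distrib)
qed

text \<open>If all entries of row \<open>v\<close> of the power \<open>Suc S\<close> were at most
  \<open>\<mu> ^ Suc S\<close>, then \<open>safe_Green\<close> would contradict
  \<open>not_safe\<close>. The conditions on the constants do not involve \<open>n\<close>,
  \<open>v\<close> or the arcs of \<open>G\<close>, so one choice serves all graphs.\<close>

lemma exists_large_diag:
  fixes \<eta> z \<mu> \<mu>' :: real
  assumes q: "2 \<le> q" "q + 1 \<le> d" and \<eta>: "0 < \<eta>" "\<eta> < 1" "3 * (3 * real q) ^ g * \<eta> \<le> 1"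
    and girth: "universal_girth G \<le> enat g"
    and K: "3 * real q \<le> K * (\<eta>\<^sup>2 / 4)" and r: "1 \<le> r * (\<eta>\<^sup>2 / 4)"
    and \<mu>': "\<mu>' = \<Delta> + sqrt q * (2 + 3 * \<eta>\<^sup>2 / 16)" and z: "0 < z" "z \<le> 1" "z * \<mu>' = 1"
    and S: "R \<le> S" "\<mu> * (\<mu> * z) ^ S < sqrt q * \<eta>\<^sup>2 / 16 * z ^ R" and R: "R = Suc (K + (Suc g + r))"
    and \<mu>: "0 \<le> \<mu>" and v: "v < n"
  shows "\<mu> ^ (2 * Suc S) \<le> (char_matrix A (- \<Delta>) ^\<^sub>m (2 * Suc S)) $$ (v, v)"
proof -
  let ?M = "char_matrix A (- \<Delta>)"
  have M: "?M \<in> carrier_mat n n" using adjacency_carrier by simp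
  have M_index: "?M $$ (i, j) = A $$ (i, j) + (if i = j then \<Delta> else 0)" if "i < n" "j < n" for i j
    using that adjacency_carrier by (simp add: char_matrix_def)
  have M_sym: "?M\<^sup>T = ?M"
  proof (rule eq_matI)
    fix i j assume "i < dim_row ?M" "j < dim_col ?M"
    then have ij: "i < n" "j < n" using M by auto
    have "?M\<^sup>T $$ (i, j) = ?M $$ (j, i)" using M ij by simp
    also have "\<dots> = ?M $$ (i, j)"
      using M_index[OF ij] M_index[OF ij(2,1)] adjacency_symmetric[OF ij] by simp
    finally show "?M\<^sup>T $$ (i, j) = ?M $$ (i, j)" .
  qed (use M in auto)
  define P where "P i x = (?M ^\<^sub>m i) $$ (v, x)" for i x
  define h where "h x = (\<Sum>j\<le>S. z ^ j * P j x)" for x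
  have loc: "superharmonic {..<n} nbrs q \<eta>"
  proof
    show "y \<in> nbrs x \<Longrightarrow> x \<in> nbrs y" for x y using arc_sym by (simp add: nbrs_def)
    show "q + 1 \<le> card (nbrs x)" if "x \<in> {..<n}" for x using card_nbrs[of x] that q by simp
  qed (use q \<eta> finite_nbrs in auto)
  interpret superharmonic "{..<n}" nbrs q h \<eta> by (rule loc)
  have P_Suc: "P (Suc i) x = \<Delta> * P i x + (\<Sum>y\<in>nbrs x. P i y)" if x: "x < n" for i x
  proof -
    have "P (Suc i) x = (\<Sum>y<n. P i y * ?M $$ (y, x))"
      unfolding P_def pow_mat.simps using M v x by (intro index_mat_mult_sum) auto
    also have "\<dots> = (\<Sum>y<n. A $$ (x, y) * P i y + (if x = y then \<Delta> * P i y else 0))"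
    proof (rule sum.cong)
      fix y assume "y \<in> {..<n}"
      then have "?M $$ (y, x) = A $$ (x, y) + (if x = y then \<Delta> else 0)"
        using M_index[of y x] adjacency_symmetric[of y x] x by auto
      then show "P i y * ?M $$ (y, x) = A $$ (x, y) * P i y + (if x = y then \<Delta> * P i y else 0)"
        by (simp add: algebra_simps)
    qed simp
    also have "\<dots> = \<Delta> * P i x + (\<Sum>y\<in>nbrs x. P i y)"
      using x by (simp add: sum.distrib sum_adjacency)
    finally show ?thesis .
  qed
  have "\<exists>x<n. P (Suc S) x > \<mu> ^ Suc S"
  proof (rule ccontr)
    assume "\<not> ?thesis"
    then have P_le: "P (Suc S) x \<le> \<mu> ^ Suc S" if "x < n" for x using that by (meson not_less)
    have "safe R v"
      using nbrs_subset v P_le P_Suc M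
      by (intro safe_Green[where P = P and D = "real \<Delta>" and S = S and \<mu> = \<mu>, OF _ _ _ _ _ _ \<mu>' z S h_def])
         (auto simp: P_def simp del: pow_mat.simps(2))
    obtain k where k: "0 < k" "k \<le> g" and
      walk: "\<And>v. v \<in> pverts G \<Longrightarrow> \<exists>p. closed_vwalk G p \<and> retracting_free p \<and> length p = k \<and> hd p = v"
      using universal_girth_le_imp[OF girth] by blast
    \<comment> \<open>The length \<open>k\<close> depends on the graph, whereas \<eta> and
      \<open>R\<close> were fixed in terms of its bound \<open>g\<close>.\<close>
    have "3 * (3 * real q) ^ k * \<eta> \<le> 3 * (3 * real q) ^ g * \<eta>"
      using q \<eta> k by (intro mult_right_mono mult_left_mono power_increasing) auto
    with \<eta> have k\<eta>: "3 * (3 * real q) ^ k * \<eta> \<le> 1" by linarith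
    have "\<not> safe (Suc (K + (Suc k + r))) v"
    proof (rule not_safe[OF _ k(1) k\<eta>])
      fix x assume "x \<in> {..<n}"
      then obtain p where p: "closed_vwalk G p" "retracting_free p" "length p = k" "hd p = x"
        using walk verts by auto
      have "closed_nb_walk k (\<lambda>i. p ! nat (i mod int (length p)))"
        using closed_nb_walk_of_list[OF loc _ p(1,2)] p(3) by (simp add: nbrs_def)
      moreover have "p ! nat (0 mod int (length p)) = x" using p k by (cases p) auto
      ultimately show "\<exists>c. c 0 = x \<and> closed_nb_walk k c"
        by (intro exI[of _ "\<lambda>i. p ! nat (i mod int (length p))"]) simp
    qed (use K r in \<open>auto simp: \<epsilon>_def\<close>)
    moreover have "safe (Suc (K + (Suc k + r))) v"
      using \<open>safe R v\<close> by (rule safe_mono) (use k R in simp)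
    ultimately show False by blast
  qed
  then obtain x where x: "x < n" "P (Suc S) x > \<mu> ^ Suc S" by blast
  have "\<mu> ^ (2 * Suc S) = (\<mu> ^ Suc S)\<^sup>2" by (simp only: power_mult[symmetric] mult.commute)
  also have "\<dots> \<le> (P (Suc S) x)\<^sup>2" using x \<mu> by (intro power_mono) auto
  also have "\<dots> \<le> (?M ^\<^sub>m (2 * Suc S)) $$ (v, v)"
    unfolding P_def by (rule symmetric_pow_diag_ge[OF M M_sym v x(1)])
  finally show ?thesis .
qed

end

theorem theorem6p2:
  fixes \<Delta> d g :: nat
  assumes "3 \<le> d" and "d \<le> \<Delta>" and "3 \<le> g"
  shows "\<exists>\<delta>::real. \<exists>c::real. \<delta> > 0 \<and> c > 0 \<and>
    (\<forall>n::nat. \<forall>G :: nat pair_pre_digraph.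
       pair_graph G \<longrightarrow> pverts G = {0..<n} \<longrightarrow>
       d \<le> min_degree G \<longrightarrow> max_degree G \<le> \<Delta> \<longrightarrow> universal_girth G \<le> enat g \<longrightarrow>
       int (size {#x \<in># eigenvalue_mset (adjacency_mat n G). x > 2 * sqrt (real d - 1) + \<delta>#})
         \<ge> \<lceil>c * real n\<rceil>)"
proof -
  define q where "q = d - 1"
  have q: "2 \<le> q" "q + 1 \<le> d" "real d - 1 = real q" using assms by (auto simp: q_def)
  \<comment> \<open>The largest value that \<open>no_closed_walk\<close> admits for length
    \<open>g\<close>.\<close>
  define \<eta> :: real where "\<eta> = 1 / (3 * (3 * real q) ^ g)"
  have "(1::real) \<le> (3 * real q) ^ g" using q by (intro one_le_power) simp
  then have \<eta>: "0 < \<eta>" "\<eta> < 1" "3 * (3 * real q) ^ g * \<eta> \<le> 1" by (auto simp: \<eta>_def)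
  have \<eta>2: "0 < \<eta>\<^sup>2" using \<eta> by simp
  obtain K :: nat where "3 * real q / (\<eta>\<^sup>2 / 4) \<le> K" using real_arch_simple by blast
  then have K: "3 * real q \<le> K * (\<eta>\<^sup>2 / 4)" using \<eta>2 by (simp add: field_simps)
  obtain r :: nat where "1 / (\<eta>\<^sup>2 / 4) \<le> r" using real_arch_simple by blast
  then have r: "1 \<le> r * (\<eta>\<^sup>2 / 4)" using \<eta>2 by (simp add: field_simps)
  define R where "R = Suc (K + (Suc g + r))"
  \<comment> \<open>The excesses over 2 \<open>sqrt q\<close> (after removing the shift \<Delta>)
    are 1, 2 and 3 sixteenths of \<open>sqrt q * \<eta>\<^sup>2\<close> for \<delta>, \<mu> and
    \<mu>'; the one allowed by \<epsilon> is 4 sixteenths.\<close>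
  define \<delta> where "\<delta> = sqrt q * \<eta>\<^sup>2 / 16"
  define \<mu> where "\<mu> = \<Delta> + sqrt q * (2 + \<eta>\<^sup>2 / 8)"
  define \<mu>' where "\<mu>' = \<Delta> + sqrt q * (2 + 3 * \<eta>\<^sup>2 / 16)"
  define z where "z = 1 / \<mu>'"
  have sq: "sqrt q > 0" using q by simp
  have \<delta>: "\<delta> > 0" using sq \<eta>2 by (simp add: \<delta>_def)
  have less: "\<Delta> + (2 * sqrt q + \<delta>) < \<mu>" "\<mu> < \<mu>'"
    using \<delta> unfolding \<mu>_def \<mu>'_def \<delta>_def by (auto simp: algebra_simps)
  have \<Delta>: "real \<Delta> \<ge> 1" using assms by simp
  have \<mu>: "0 \<le> \<mu>" "1 \<le> \<mu>'" using less \<delta> \<Delta> sq by linarith+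
  have z: "0 < z" "z \<le> 1" "z * \<mu>' = 1" using \<mu> by (auto simp: z_def)
  obtain S where S: "R \<le> S" "\<mu> * (\<mu> * z) ^ S < sqrt q * \<eta>\<^sup>2 / 16 * z ^ R"
    using exists_truncation[OF \<mu>(1) less(2) z(3), of "sqrt q * \<eta>\<^sup>2 / 16 * z ^ R" R] z \<delta>
    by (auto simp: \<delta>_def)
  \<comment> \<open>Even, because a squared entry of the power \<open>Suc S\<close> bounds the
    diagonal from below.\<close>
  define m where "m = 2 * Suc S"
  \<comment> \<open>This is \<open>count_eigenvalues_ge\<close> solved for the count per
    vertex.\<close>
  define c where "c = (\<mu> ^ m - (\<Delta> + (2 * sqrt q + \<delta>)) ^ m) / (2 * \<Delta>) ^ m"
  have pos: "(2 * real \<Delta>) ^ m > 0" using \<Delta> by simp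
  have "(\<Delta> + (2 * sqrt q + \<delta>)) ^ m < \<mu> ^ m"
    using less \<delta> sq by (intro power_strict_mono) (auto simp: m_def)
  then have c: "c > 0" using pos by (simp add: c_def)
  have "\<lceil>c * real n\<rceil> \<le> int (size {#x \<in># eigenvalue_mset (adjacency_mat n G). x > 2 * sqrt (real d - 1) + \<delta>#})"
    if G: "pair_graph G" "pverts G = {0..<n}" "d \<le> min_degree G" "max_degree G \<le> \<Delta>"
      "universal_girth G \<le> enat g" for n G
  proof -
    interpret adjacency G n d \<Delta> using G(1-4) by (rule adjacency.intro)
    have "n * (\<mu> ^ m - (\<Delta> + (2 * sqrt q + \<delta>)) ^ m)
        \<le> size {#x \<in># eigenvalue_mset (adjacency_mat n G). x > 2 * sqrt q + \<delta>#} * (2 * \<Delta>) ^ m"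
      unfolding m_def
      using exists_large_diag[OF q(1,2) \<eta> G(5) K r \<mu>'_def z S R_def \<mu>(1)] \<delta> sq
      by (intro count_eigenvalues_ge) auto
    then have "c * n \<le> size {#x \<in># eigenvalue_mset (adjacency_mat n G). x > 2 * sqrt q + \<delta>#}"
      using pos by (simp add: c_def field_simps)
    then show ?thesis unfolding q(3) by (simp add: ceiling_le_iff)
  qed
  then show ?thesis using \<delta> c by blast
qed

end
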